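(* Let $\Pi$ be a graph property that is closed under adding degree-one vertices. There is a function $f\colon\mathbb N\to\mathbb N$ such that, for each fixed $m\in\mathbb N$, there is an algorithm that decides whether a given hypergraph $\mathcal H$ with $m$ hyperedges has a support satisfying $\Pi$ in time $f(m)\cdot\mathrm{poly}(|\mathcal H|)$.
   Context: Hypergraphs have no hyperedges of size at most one and no repeated hyperedges. A support for a hypergraph $\mathcal H=(\mathcal V,\mathcal E)$ is a graph on vertex set $\mathcal V$ such that each hyperedge induces a connected subgraph. A graph property $\Pi$ is closed under adding degree-one vertices if whenever $G$ satisfies $\Pi$, so does any graph obtained from $G$ by adding a new vertex adjacent to exactly one vertex of $G$. *)

theory Defs
  imports "Graph_Theory.Graph_Theory" "HOL-Computational_Algebra.Polynomial"
begin

section \<open>Graph properties\<close>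

text \<open>Finite simple undirected graphs are the symmetric loop-free \<^const>\<open>pair_graph\<close>s: an edge
  between \<open>u\<close> and \<open>v\<close> is the pair of arcs \<open>(u, v)\<close> and \<open>(v, u)\<close>.  Vertices are natural numbers; as
  properties are isomorphism invariant, this covers all finite graphs.\<close>

type_synonym ngraph = "nat pair_pre_digraph"

definition graph_property :: "(ngraph \<Rightarrow> bool) \<Rightarrow> bool" where
  "graph_property P \<longleftrightarrow>
     (\<forall>G G'. pair_graph G \<and> pair_graph G' \<and> digraph_iso (with_proj G) (with_proj G') \<and> P G
        \<longrightarrow> P G')"

definition add_leaf :: "ngraph \<Rightarrow> nat \<Rightarrow> nat \<Rightarrow> ngraph" where
  "add_leaf G u v =
     \<lparr> pverts = insert v (pverts G), parcs = parcs G \<union> {(u, v), (v, u)} \<rparr>"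

definition closed_under_adding_leaves :: "(ngraph \<Rightarrow> bool) \<Rightarrow> bool" where
  "closed_under_adding_leaves P \<longleftrightarrow>
     (\<forall>G u v. pair_graph G \<and> P G \<and> u \<in> pverts G \<and> v \<notin> pverts G \<longrightarrow> P (add_leaf G u v))"


section \<open>Hypergraphs and supports\<close>

record hypergraph =
  hverts :: "nat set"
  hedges :: "nat set set"

definition wf_hypergraph :: "hypergraph \<Rightarrow> bool" where
  "wf_hypergraph H \<longleftrightarrow>
     finite (hverts H) \<and> (\<forall>e\<in>hedges H. e \<subseteq> hverts H \<and> 2 \<le> card e)"

definition support :: "hypergraph \<Rightarrow> ngraph \<Rightarrow> bool" where
  "support H G \<longleftrightarrow>
     pair_graph G \<and> pverts G = hverts H \<and>
     (\<forall>e\<in>hedges H. Digraph_Component.connected (with_proj G \<restriction> e))"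

definition has_support_satisfying :: "(ngraph \<Rightarrow> bool) \<Rightarrow> hypergraph \<Rightarrow> bool" where
  "has_support_satisfying P H \<longleftrightarrow> (\<exists>G. support H G \<and> P G)"


section \<open>Deterministic multi-tape Turing machines\<close>

text \<open>Symbols and states are initial segments of the natural numbers; symbol \<open>0\<close> is the blank
  and \<open>1, \<dots>, 4\<close> form the input alphabet.  Tapes are infinite in both directions.\<close>

datatype move = Move_Left | Stay | Move_Right

primrec offset :: "move \<Rightarrow> int" where
  "offset Move_Left = -1"
| "offset Stay = 0"
| "offset Move_Right = 1"

record tm =
  n_tapes :: nat
  n_symbols :: nat
  n_states :: nat
  start_state :: nat
  accept_state :: nat
  reject_state :: nat
  transition :: "nat \<Rightarrow> nat list \<Rightarrow> nat \<times> (nat \<times> move) list"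

definition turing_machine :: "tm \<Rightarrow> bool" where
  "turing_machine M \<longleftrightarrow>
     1 \<le> n_tapes M \<and> 5 \<le> n_symbols M \<and>
     start_state M < n_states M \<and> accept_state M < n_states M \<and> reject_state M < n_states M \<and>
     accept_state M \<noteq> reject_state M \<and>
     (\<forall>q syms q' acts.
        q < n_states M \<and> length syms = n_tapes M \<and> set syms \<subseteq> {..<n_symbols M} \<and>
        transition M q syms = (q', acts) \<longrightarrow>
        q' < n_states M \<and> length acts = n_tapes M \<and> fst ` set acts \<subseteq> {..<n_symbols M})"

text \<open>A tape is its contents together with the position of its head.\<close>

type_synonym tape = "(int \<Rightarrow> nat) \<times> int"

type_synonym config = "nat \<times> tape list"

fun act :: "nat \<times> move \<Rightarrow> tape \<Rightarrow> tape" where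
  "act (s, d) (t, h) = (t(h := s), h + offset d)"

fun step :: "tm \<Rightarrow> config \<Rightarrow> config" where
  "step M (q, ts) =
     (if q = accept_state M \<or> q = reject_state M then (q, ts)
      else let (q', acts) = transition M q (map (\<lambda>(t, h). t h) ts)
           in (q', map2 act acts ts))"

definition input_tape :: "nat list \<Rightarrow> tape" where
  "input_tape w = (\<lambda>i. if 0 \<le> i \<and> i < int (length w) then w ! nat i else 0, 0)"

definition initial_config :: "tm \<Rightarrow> nat list \<Rightarrow> config" where
  "initial_config M w =
     (start_state M, input_tape w # replicate (n_tapes M - 1) (input_tape []))"

definition answers_within :: "tm \<Rightarrow> nat list \<Rightarrow> bool \<Rightarrow> nat \<Rightarrow> bool" where
  "answers_within M w b t \<longleftrightarrow>
     (\<exists>s\<le>t. fst ((step M ^^ s) (initial_config M w)) =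
        (if b then accept_state M else reject_state M))"


section \<open>Hypergraphs as input words\<close>

text \<open>Vertex names are written in binary, least significant digit first, with the digits
  \<open>0\<close> and \<open>1\<close> represented by the symbols \<open>1\<close> and \<open>2\<close>.  Symbol \<open>3\<close> terminates a vertex name and symbol
  \<open>4\<close> terminates a list of vertices.  A hypergraph is written as the list of its vertices followed
  by its hyperedges, each as a list of vertices; all lists may be in any order.
  The size of a hypergraph is the length of such a word, which does not depend on the orders chosen.\<close>

fun binary :: "nat \<Rightarrow> nat list" where
  "binary n = (if n < 2 then [n + 1] else (n mod 2 + 1) # binary (n div 2))"

declare binary.simps [simp del]

definition encode_vertices :: "nat list \<Rightarrow> nat list" where
  "encode_vertices vs = concat (map (\<lambda>v. binary v @ [3]) vs) @ [4]"

definition encodes :: "nat list \<Rightarrow> hypergraph \<Rightarrow> bool" where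
  "encodes w H \<longleftrightarrow>
     (\<exists>vs es. distinct vs \<and> set vs = hverts H \<and>
        (\<forall>e\<in>set es. distinct e) \<and> distinct (map set es) \<and> set (map set es) = hedges H \<and>
        w = concat (map encode_vertices (vs # es)))"

end

theory Submission
  imports Defs "HOL-Library.Countable_Set"
begin

text \<open>Call the set of hyperedges containing a vertex its type.  Up to isomorphism a hypergraph with
  \<open>m\<close> hyperedges is given by the number of vertices of each type.  If a support satisfies the
  property, a new vertex of an already occurring type can be attached as a leaf to a vertex of the
  same type, so the positive instances are closed under increasing nonzero counts.  By Dickson's
  lemma there is then a bound \<open>N\<close> such that the answer depends only on the counts truncated at \<open>N\<close>.
  A Turing machine with the answers for the finitely many truncated vectors built into it only has
  to count the vertices of each type up to \<open>N\<close>; its number of states depends on \<open>m\<close>, but its running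
  time is quadratic with an absolute constant.\<close>

section \<open>Supports and vertex types\<close>

lemma pair_graph_iff:
  "pair_graph G \<longleftrightarrow>
     finite (pverts G) \<and> parcs G \<subseteq> pverts G \<times> pverts G \<and> sym (parcs G) \<and> irrefl (parcs G)"
proof
  assume "pair_graph G"
  then interpret pair_graph G .
  show "finite (pverts G) \<and> parcs G \<subseteq> pverts G \<times> pverts G \<and> sym (parcs G) \<and> irrefl (parcs G)"
    using pair_finite_verts arc_fst_in_verts arc_snd_in_verts arcs_symmetric pair_no_loops
    by (fastforce simp: sym_def irrefl_def)
next
  assume G: "finite (pverts G) \<and> parcs G \<subseteq> pverts G \<times> pverts G \<and> sym (parcs G) \<and> irrefl (parcs G)"
  then have "finite (parcs G)"
    by (meson finite_SigmaI finite_subset)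
  with G show "pair_graph G"
    by unfold_locales (auto simp: symmetric_def irrefl_def)
qed

definition connected_on :: "'a set \<Rightarrow> 'a rel \<Rightarrow> bool" where
  "connected_on S R \<longleftrightarrow> S \<noteq> {} \<and> S \<times> S \<subseteq> rtrancl_on S R"

lemma rtrancl_on_subset:
  assumes "R \<subseteq> R'" "S \<subseteq> S'"
  shows "rtrancl_on S R \<subseteq> rtrancl_on S' R'"
  by (intro subrelI rtrancl_on_mono[OF assms])

lemma rtrancl_on_Restr: "rtrancl_on S (Restr R S) = rtrancl_on S R"
proof
  show "rtrancl_on S (Restr R S) \<subseteq> rtrancl_on S R"
    by (intro rtrancl_on_subset) auto
  show "rtrancl_on S R \<subseteq> rtrancl_on S (Restr R S)"
  proof (rule subrelI)
    fix u v
    assume "(u, v) \<in> rtrancl_on S R"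
    then show "(u, v) \<in> rtrancl_on S (Restr R S)"
    proof induction
      case (step x y)
      then show ?case
        by (intro converse_rtrancl_on_into_rtrancl_on[OF _ step.IH]) auto
    qed simp
  qed
qed

lemma connected_induce_subgraph_iff:
  assumes "pair_graph G"
  shows "Digraph_Component.connected (with_proj G \<restriction> S) \<longleftrightarrow> connected_on S (parcs G)"
proof -
  have "(arcs_ends (with_proj G \<restriction> S))\<^sup>s = Restr (parcs G) S"
    using assms by (auto simp: pair_graph_iff symcl_def arcs_ends_conv induce_subgraph_def sym_def)
  then show ?thesis
    by (auto simp: connected_conv connected_on_def rtrancl_on_Restr)
qed

lemma connected_on_mono:
  assumes "connected_on S R" "R \<subseteq> R'"
  shows "connected_on S R'"
  using assms(1) rtrancl_on_subset[OF assms(2) subset_refl] unfolding connected_on_def by blast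

lemma connected_on_insert:
  assumes S: "connected_on S R" and u: "u \<in> S" "(u, v) \<in> R" "(v, u) \<in> R"
  shows "connected_on (insert v S) R"
proof -
  let ?Q = "rtrancl_on (insert v S) R"
  have "rtrancl_on S R \<subseteq> ?Q"
    by (intro rtrancl_on_subset) auto
  with S have "S \<times> S \<subseteq> ?Q"
    by (auto simp: connected_on_def)
  moreover have "(u, v) \<in> ?Q" "(v, u) \<in> ?Q" "(v, v) \<in> ?Q"
    using u by (simp_all add: rtrancl_on_into_rtrancl_on[OF rtrancl_on_refl])
  ultimately have "(x, u) \<in> ?Q" "(u, x) \<in> ?Q" if "x \<in> insert v S" for x
    using that u(1) by auto
  then show ?thesis
    unfolding connected_on_def by (blast intro: rtrancl_on_trans)
qed

lemma connected_on_image: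
  assumes "connected_on S R"
  shows "connected_on (\<phi> ` S) (map_prod \<phi> \<phi> ` R)"
proof -
  have "(\<phi> u, \<phi> v) \<in> rtrancl_on (\<phi> ` S) (map_prod \<phi> \<phi> ` R)" if "(u, v) \<in> rtrancl_on S R" for u v
    using that
  proof induction
    case (step y z)
    then have "(\<phi> y, \<phi> z) \<in> map_prod \<phi> \<phi> ` R" "\<phi> y \<in> \<phi> ` S"
      by force+
    from this(1) step.IH this(2) show ?case
      by (rule converse_rtrancl_on_into_rtrancl_on)
  qed simp
  with assms show ?thesis
    by (auto simp: connected_on_def)
qed

definition map_graph :: "('a \<Rightarrow> 'b) \<Rightarrow> 'a pair_pre_digraph \<Rightarrow> 'b pair_pre_digraph" where
  "map_graph \<phi> G = \<lparr>pverts = \<phi> ` pverts G, parcs = map_prod \<phi> \<phi> ` parcs G\<rparr>"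

lemma map_graph_simps [simp]:
  "pverts (map_graph \<phi> G) = \<phi> ` pverts G"
  "parcs (map_graph \<phi> G) = map_prod \<phi> \<phi> ` parcs G"
  by (simp_all add: map_graph_def)

lemma pair_graph_map_graph:
  assumes "pair_graph G" "inj_on \<phi> (pverts G)"
  shows "pair_graph (map_graph \<phi> G)"
  using assms unfolding pair_graph_iff
  by (auto simp: sym_def irrefl_def inj_on_def) (metis SigmaD1 SigmaD2 subsetD)+

lemma digraph_iso_map_graph:
  assumes "pair_graph G" and inj: "inj_on \<phi> (pverts G)"
  shows "digraph_iso (with_proj G) (with_proj (map_graph \<phi> G))"
proof -
  define f where "f = \<lparr>iso_verts = \<phi>, iso_arcs = map_prod \<phi> \<phi>, iso_head = snd, iso_tail = fst\<rparr>"
  have arcs: "parcs G \<subseteq> pverts G \<times> pverts G"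
    using assms(1) by (simp add: pair_graph_iff)
  then have "inj_on (map_prod \<phi> \<phi>) (parcs G)"
    by (rule inj_on_subset[OF map_prod_inj_on[OF inj inj]])
  then have "pre_digraph.digraph_isomorphism (with_proj G) f"
    using inj arcs
    by (auto simp: pre_digraph.digraph_isomorphism_def f_def wf_digraph_wp_iff pair_wf_digraph_def)
  moreover have "with_proj (map_graph \<phi> G) = app_iso f (with_proj G)"
    by (simp add: with_proj_def app_iso_def f_def)
  ultimately show ?thesis
    unfolding digraph_iso_def by blast
qed

text \<open>A hypergraph with hyperedges indexed by \<open>J\<close> is given by its vertex set and the map \<open>\<tau>\<close>
  that sends a vertex to the set of indices of the hyperedges containing it, its type.\<close>

definition indexed_support :: "'j set \<Rightarrow> ('a \<Rightarrow> 'j set) \<Rightarrow> 'a pair_pre_digraph \<Rightarrow> bool" where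
  "indexed_support J \<tau> G \<longleftrightarrow>
     pair_graph G \<and> (\<forall>j\<in>J. connected_on {v \<in> pverts G. j \<in> \<tau> v} (parcs G))"

lemma indexed_support_map_graph:
  assumes G: "indexed_support J \<tau> G" and inj: "inj_on \<phi> (pverts G)"
    and \<tau>: "\<And>v. v \<in> pverts G \<Longrightarrow> \<tau>' (\<phi> v) = \<tau> v"
  shows "indexed_support J \<tau>' (map_graph \<phi> G)"
proof -
  have "{v \<in> \<phi> ` pverts G. j \<in> \<tau>' v} = \<phi> ` {v \<in> pverts G. j \<in> \<tau> v}" for j
    using \<tau> by auto
  with G inj show ?thesis
    by (simp add: indexed_support_def pair_graph_map_graph connected_on_image)
qed

lemma indexed_support_add_leaf:
  assumes G: "indexed_support J \<tau> G" and u: "u \<in> pverts G" and v: "v \<notin> pverts G"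
    and \<tau>: "\<tau> v \<subseteq> \<tau> u"
  shows "indexed_support J \<tau> (add_leaf G u v)"
proof -
  let ?G = "add_leaf G u v" and ?E = "\<lambda>V j. {x \<in> V. j \<in> \<tau> x}"
  have "connected_on (?E (insert v (pverts G)) j) (parcs ?G)" if "j \<in> J" for j
  proof -
    have old_edge: "connected_on (?E (pverts G) j) (parcs ?G)"
      using G that by (auto simp: indexed_support_def add_leaf_def intro: connected_on_mono)
    show ?thesis
    proof (cases "j \<in> \<tau> v")
      case True
      then have "?E (insert v (pverts G)) j = insert v (?E (pverts G) j)"
        by auto
      also have "connected_on \<dots> (parcs ?G)"
        using True u \<tau> by (intro connected_on_insert[OF old_edge, of u]) (auto simp: add_leaf_def)
      finally show ?thesis .
    next
      case False
      then have "?E (insert v (pverts G)) j = ?E (pverts G) j"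
        by auto
      with old_edge show ?thesis
        by simp
    qed
  qed
  moreover have "pair_graph ?G"
    using G u v by (auto simp: indexed_support_def pair_graph_iff add_leaf_def sym_def irrefl_def)
  ultimately show ?thesis
    by (simp add: indexed_support_def add_leaf_def)
qed

definition has_indexed_support ::
    "(ngraph \<Rightarrow> bool) \<Rightarrow> 'j set \<Rightarrow> nat set \<Rightarrow> (nat \<Rightarrow> 'j set) \<Rightarrow> bool" where
  "has_indexed_support P J V \<tau> \<longleftrightarrow> (\<exists>G. indexed_support J \<tau> G \<and> pverts G = V \<and> P G)"

lemma has_indexed_support_image:
  assumes P: "graph_property P" and sup: "has_indexed_support P J V \<tau>"
    and inj: "inj_on \<phi> V" and \<tau>: "\<And>v. v \<in> V \<Longrightarrow> \<tau>' (\<phi> v) = \<tau> v"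
  shows "has_indexed_support P J (\<phi> ` V) \<tau>'"
proof -
  obtain G where G: "indexed_support J \<tau> G" "pverts G = V" "P G"
    using sup by (auto simp: has_indexed_support_def)
  then have "pair_graph G"
    by (simp add: indexed_support_def)
  with P G inj have "P (map_graph \<phi> G)"
    using pair_graph_map_graph digraph_iso_map_graph unfolding graph_property_def by blast
  with indexed_support_map_graph[OF G(1)] G(2) inj \<tau> show ?thesis
    unfolding has_indexed_support_def by (metis map_graph_simps(1))
qed

lemma has_indexed_support_insert:
  assumes P: "closed_under_adding_leaves P" and sup: "has_indexed_support P J V \<tau>"
    and u: "u \<in> V" and v: "v \<notin> V" and \<tau>: "\<tau> v \<subseteq> \<tau> u"
  shows "has_indexed_support P J (insert v V) \<tau>"
proof -
  obtain G where G: "indexed_support J \<tau> G" "pverts G = V" "P G"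
    using sup by (auto simp: has_indexed_support_def)
  with P u v have "P (add_leaf G u v)"
    by (auto simp: closed_under_adding_leaves_def indexed_support_def)
  moreover have "indexed_support J \<tau> (add_leaf G u v)"
    using G u v \<tau> by (intro indexed_support_add_leaf) auto
  ultimately show ?thesis
    using G(2) unfolding has_indexed_support_def
    by (intro exI[of _ "add_leaf G u v"]) (simp add: add_leaf_def)
qed

lemma has_indexed_support_Un:
  assumes P: "closed_under_adding_leaves P" and sup: "has_indexed_support P J V \<tau>"
    and "finite W" "\<And>w. w \<in> W \<Longrightarrow> \<exists>u\<in>V. \<tau> w \<subseteq> \<tau> u"
  shows "has_indexed_support P J (V \<union> W) \<tau>"
  using assms(3,4)
proof (induction W)
  case empty
  show ?case using sup by simp
next
  case (insert w W)
  then have IH: "has_indexed_support P J (V \<union> W) \<tau>"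
    by simp
  show ?case
  proof (cases "w \<in> V")
    case True
    with IH show ?thesis by (simp add: insert_absorb)
  next
    case False
    obtain u where "u \<in> V" "\<tau> w \<subseteq> \<tau> u"
      using insert.prems by auto
    with has_indexed_support_insert[OF P IH, of u w] False insert.hyps show ?thesis
      by auto
  qed
qed

definition type_count :: "'a set \<Rightarrow> ('a \<Rightarrow> 't) \<Rightarrow> 't \<Rightarrow> nat" where
  "type_count V \<tau> T = card {v \<in> V. \<tau> v = T}"

lemma type_count_eq_0_iff:
  assumes "finite V"
  shows "type_count V \<tau> T = 0 \<longleftrightarrow> T \<notin> \<tau> ` V"
  using assms by (auto simp: type_count_def)

lemma type_count_insert:
  assumes "finite V" "v \<notin> V"
  shows "type_count (insert v V) \<tau> = (type_count V \<tau>)(\<tau> v := Suc (type_count V \<tau> (\<tau> v)))"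
proof
  fix T
  have "{x \<in> insert v V. \<tau> x = T} =
      (if \<tau> v = T then insert v {x \<in> V. \<tau> x = T} else {x \<in> V. \<tau> x = T})"
    by auto
  with assms show
    "type_count (insert v V) \<tau> T = ((type_count V \<tau>)(\<tau> v := Suc (type_count V \<tau> (\<tau> v)))) T"
    by (simp add: type_count_def)
qed

lemma type_preserving_injection:
  assumes fin: "finite V" "finite V'"
    and counts_le: "\<And>T. T \<in> \<tau> ` V \<Longrightarrow> type_count V \<tau> T \<le> type_count V' \<tau>' T"
  obtains \<phi> where "inj_on \<phi> V" "\<phi> ` V \<subseteq> V'" "\<And>v. v \<in> V \<Longrightarrow> \<tau>' (\<phi> v) = \<tau> v"
proof -
  let ?F = "\<lambda>T. {v \<in> V. \<tau> v = T}" and ?F' = "\<lambda>T. {v \<in> V'. \<tau>' v = T}"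
  have "\<forall>T\<in>\<tau> ` V. \<exists>g. g ` ?F T \<subseteq> ?F' T \<and> inj_on g (?F T)"
    using fin counts_le by (intro ballI card_le_inj) (auto simp: type_count_def)
  from bchoice[OF this] obtain g
    where class_inj: "\<forall>T\<in>\<tau> ` V. g T ` ?F T \<subseteq> ?F' T \<and> inj_on (g T) (?F T)"
    by blast
  define \<phi> where "\<phi> v = g (\<tau> v) v" for v
  have preserving: "\<phi> v \<in> V'" "\<tau>' (\<phi> v) = \<tau> v" if "v \<in> V" for v
    using class_inj that by (auto simp: \<phi>_def)
  have "inj_on \<phi> V"
  proof (rule inj_onI)
    fix x y
    assume xy: "x \<in> V" "y \<in> V" "\<phi> x = \<phi> y"
    with preserving(2) have "\<tau> x = \<tau> y"
      by metis
    with xy class_inj show "x = y"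
      by (auto simp: \<phi>_def inj_on_def)
  qed
  with preserving that show thesis
    by blast
qed

section \<open>Truncated type counts\<close>

definition truncated_count :: "nat \<Rightarrow> 'a set \<Rightarrow> ('a \<Rightarrow> 't) \<Rightarrow> 't \<Rightarrow> nat" where
  "truncated_count N V \<tau> T = min N (type_count V \<tau> T)"

definition supp_le_on :: "'i set \<Rightarrow> ('i \<Rightarrow> nat) \<Rightarrow> ('i \<Rightarrow> nat) \<Rightarrow> bool" where
  "supp_le_on I c c' \<longleftrightarrow> (\<forall>T\<in>I. c T \<le> c' T \<and> (c T = 0 \<longrightarrow> c' T = 0))"

lemma supp_le_on_refl: "supp_le_on I c c"
  by (simp add: supp_le_on_def)

lemma supp_le_on_trans: "supp_le_on I a b \<Longrightarrow> supp_le_on I b c \<Longrightarrow> supp_le_on I a c"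
  by (auto simp: supp_le_on_def intro: order_trans)

lemma has_indexed_support_mono:
  assumes P: "graph_property P" "closed_under_adding_leaves P"
    and sup: "has_indexed_support P J V \<tau>" and fin: "finite V" "finite V'"
    and types: "\<tau> ` V \<subseteq> I" "\<tau>' ` V' \<subseteq> I"
    and counts_le: "supp_le_on I (type_count V \<tau>) (type_count V' \<tau>')"
  shows "has_indexed_support P J V' \<tau>'"
proof -
  have "type_count V \<tau> T \<le> type_count V' \<tau>' T" if "T \<in> \<tau> ` V" for T
    using counts_le types(1) that by (auto simp: supp_le_on_def)
  then obtain \<phi> where \<phi>: "inj_on \<phi> V" "\<phi> ` V \<subseteq> V'" "\<And>v. v \<in> V \<Longrightarrow> \<tau>' (\<phi> v) = \<tau> v"
    using type_preserving_injection[OF fin] by metis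
  have "has_indexed_support P J (\<phi> ` V) \<tau>'"
    using P(1) sup \<phi>(1,3) by (rule has_indexed_support_image)
  moreover have "\<exists>u\<in>\<phi> ` V. \<tau>' w \<subseteq> \<tau>' u" if "w \<in> V'" for w
  proof -
    have "type_count V' \<tau>' (\<tau>' w) \<noteq> 0" "\<tau>' w \<in> I"
      using types(2) that fin(2) by (auto simp: type_count_eq_0_iff)
    with counts_le have "type_count V \<tau> (\<tau>' w) \<noteq> 0"
      by (auto simp: supp_le_on_def)
    then obtain v where "v \<in> V" "\<tau>' w = \<tau> v"
      using fin(1) by (auto simp: type_count_eq_0_iff)
    with \<phi>(3) show ?thesis
      by auto
  qed
  ultimately have "has_indexed_support P J (\<phi> ` V \<union> V') \<tau>'"
    using P(2) fin(2) by (intro has_indexed_support_Un)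
  with \<phi>(2) show ?thesis
    by (simp add: Un_absorb1)
qed

lemma incseq_subseq_wellorder:
  fixes a :: "nat \<Rightarrow> 'a::wellorder"
  shows "\<exists>r :: nat \<Rightarrow> nat. strict_mono r \<and> incseq (\<lambda>n. a (r n))"
proof -
  obtain r :: "nat \<Rightarrow> nat" where r: "strict_mono r" "monoseq (\<lambda>n. a (r n))"
    using seq_monosub by blast
  from r(2) consider (inc) "incseq (\<lambda>n. a (r n))" | (dec) "decseq (\<lambda>n. a (r n))"
    by (auto simp: monoseq_iff)
  then show ?thesis
  proof cases
    case inc
    with r(1) show ?thesis by blast
  next
    case dec
    have "(LEAST x. x \<in> range (\<lambda>n. a (r n))) \<in> range (\<lambda>n. a (r n))"
      by (rule LeastI) blast
    then obtain k where "(LEAST x. x \<in> range (\<lambda>n. a (r n))) = a (r k)"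
      by (rule rangeE)
    then have least: "a (r k) \<le> a (r n)" for n
      by (metis Least_le rangeI)
    have "a (r (k + n)) = a (r k)" for n
      using least[of "k + n"] dec by (intro order_antisym) (auto simp: decseq_def)
    then have "incseq (\<lambda>n. a (r (k + n)))"
      by (simp add: incseq_def)
    moreover have "strict_mono (\<lambda>n. r (k + n))"
      using r(1) by (simp add: strict_mono_def)
    ultimately show ?thesis
      by blast
  qed
qed

lemma Dickson_subseq:
  fixes a :: "nat \<Rightarrow> 'i \<Rightarrow> 'a::wellorder"
  assumes "finite I"
  shows "\<exists>r :: nat \<Rightarrow> nat. strict_mono r \<and> (\<forall>T\<in>I. incseq (\<lambda>n. a (r n) T))"
  using assms
proof induction
  case empty
  show ?case by (intro exI[of _ id]) (simp add: strict_mono_def)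
next
  case (insert S I)
  then obtain r :: "nat \<Rightarrow> nat" where r: "strict_mono r" "\<And>T. T \<in> I \<Longrightarrow> incseq (\<lambda>n. a (r n) T)"
    by blast
  obtain s :: "nat \<Rightarrow> nat" where s: "strict_mono s" "incseq (\<lambda>n. a (r (s n)) S)"
    using incseq_subseq_wellorder[of "\<lambda>n. a (r n) S"] by blast
  have "incseq (\<lambda>n. a (r (s n)) T)" if "T \<in> I" for T
    using r(2)[OF that] s(1) by (simp add: incseq_def strict_mono_less_eq)
  with r(1) s show ?case
    by (intro exI[of _ "\<lambda>n. r (s n)"]) (auto simp: strict_mono_def)
qed

lemma supp_le_on_subseq:
  fixes a :: "nat \<Rightarrow> 'i \<Rightarrow> nat"
  assumes "finite I"
  obtains r :: "nat \<Rightarrow> nat" where "strict_mono r" "\<And>i j. i \<le> j \<Longrightarrow> supp_le_on I (a (r i)) (a (r j))"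
proof -
  \<comment> \<open>With the indicator of its vanishing as a second component for each count, the order becomes the
    componentwise one.\<close>
  define a' where "a' n = case_sum (a n) (\<lambda>T. of_bool (a n T = 0))" for n
  obtain r :: "nat \<Rightarrow> nat" where r: "strict_mono r" "\<forall>X\<in>I <+> I. incseq (\<lambda>n. a' (r n) X)"
    using Dickson_subseq[of "I <+> I" a'] assms by auto
  have "supp_le_on I (a (r i)) (a (r j))" if "i \<le> j" for i j
    unfolding supp_le_on_def
  proof
    fix T assume "T \<in> I"
    then have "incseq (\<lambda>n. a' (r n) (Inl T))" "incseq (\<lambda>n. a' (r n) (Inr T))"
      using r(2) by blast+
    from incseqD[OF this(1) that] incseqD[OF this(2) that]
    show "a (r i) T \<le> a (r j) T \<and> (a (r i) T = 0 \<longrightarrow> a (r j) T = 0)"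
      by (auto simp: a'_def of_bool_def split: if_splits)
  qed
  with r(1) that show thesis
    by blast
qed

lemma truncation_threshold:
  fixes A :: "('i \<Rightarrow> nat) set"
  assumes "finite I" and upward_closed: "\<And>c c'. c \<in> A \<Longrightarrow> supp_le_on I c c' \<Longrightarrow> c' \<in> A"
  shows "\<exists>N. \<forall>c. (\<lambda>T. min N (c T)) \<in> A \<longleftrightarrow> c \<in> A"
proof (rule ccontr)
  assume contra: "\<not> ?thesis"
  have "\<exists>c. c \<in> A \<and> (\<lambda>T. min (Suc N) (c T)) \<notin> A" for N
  proof -
    obtain c where "(\<lambda>T. min (Suc N) (c T)) \<in> A \<longleftrightarrow> c \<notin> A"
      using contra by blast
    moreover have "supp_le_on I (\<lambda>T. min (Suc N) (c T)) c"
      by (auto simp: supp_le_on_def min_def split: if_splits)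
    ultimately show ?thesis
      using upward_closed by blast
  qed
  then obtain a where in_A: "\<And>N. a N \<in> A" and not_in_A: "\<And>N. (\<lambda>T. min (Suc N) (a N T)) \<notin> A"
    by metis
  obtain r :: "nat \<Rightarrow> nat"
    where r: "strict_mono r" "\<And>i j. i \<le> j \<Longrightarrow> supp_le_on I (a (r i)) (a (r j))"
    using supp_le_on_subseq[OF \<open>finite I\<close>] by blast
  define j where "j = (\<Sum>T\<in>I. a (r 0) T)"
  have "a (r 0) T \<le> r j" if "T \<in> I" for T
  proof -
    have "a (r 0) T \<le> j"
      unfolding j_def using that \<open>finite I\<close> by (simp add: member_le_sum)
    also have "j \<le> r j"
      using r(1) by (rule strict_mono_imp_increasing)
    finally show ?thesis .
  qed
  then have "supp_le_on I (a (r 0)) (\<lambda>T. min (Suc (r j)) (a (r j) T))"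
    using r(2)[of 0 j] by (force simp: supp_le_on_def)
  with upward_closed in_A not_in_A show False
    by blast
qed

lemma has_indexed_support_truncated_count:
  assumes P: "graph_property P" "closed_under_adding_leaves P" and "finite I"
  obtains N D where "\<And>V \<tau>. \<lbrakk>finite V; \<tau> ` V \<subseteq> I\<rbrakk> \<Longrightarrow>
    has_indexed_support P J V \<tau> \<longleftrightarrow> D (truncated_count N V \<tau>)"
proof -
  define A where "A = {c. \<exists>V \<tau>. finite V \<and> \<tau> ` V \<subseteq> I \<and> has_indexed_support P J V \<tau> \<and>
    supp_le_on I (type_count V \<tau>) c}"
  have "c' \<in> A" if "c \<in> A" and counts_le: "supp_le_on I c c'" for c c'
  proof -
    obtain V \<tau> where "finite V" "\<tau> ` V \<subseteq> I" "has_indexed_support P J V \<tau>"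
      "supp_le_on I (type_count V \<tau>) c"
      using \<open>c \<in> A\<close> unfolding A_def by blast
    moreover from this(4) counts_le have "supp_le_on I (type_count V \<tau>) c'"
      by (rule supp_le_on_trans)
    ultimately show ?thesis
      unfolding A_def by blast
  qed
  then obtain N where threshold: "\<And>c. (\<lambda>T. min N (c T)) \<in> A \<longleftrightarrow> c \<in> A"
    using truncation_threshold[OF \<open>finite I\<close>, of A] by blast
  have "has_indexed_support P J V \<tau> \<longleftrightarrow> type_count V \<tau> \<in> A"
    if V: "finite V" "\<tau> ` V \<subseteq> I" for V \<tau>
  proof
    assume "has_indexed_support P J V \<tau>"
    with V supp_le_on_refl[of I "type_count V \<tau>"] show "type_count V \<tau> \<in> A"
      unfolding A_def by blast
  next
    assume "type_count V \<tau> \<in> A"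
    then obtain U \<sigma> where "has_indexed_support P J U \<sigma>" "finite U" "\<sigma> ` U \<subseteq> I"
      and counts_le: "supp_le_on I (type_count U \<sigma>) (type_count V \<tau>)"
      unfolding A_def by blast
    from has_indexed_support_mono[OF P this(1,2) V(1) this(3) V(2) counts_le]
    show "has_indexed_support P J V \<tau>" .
  qed
  with threshold that[of "\<lambda>c. c \<in> A" N] show thesis
    by (simp add: truncated_count_def[abs_def])
qed

section \<open>Machines with arbitrary states\<close>

definition reaches :: "('c \<Rightarrow> 'c) \<Rightarrow> nat \<Rightarrow> 'c \<Rightarrow> 'c \<Rightarrow> bool" where
  "reaches f t x y \<longleftrightarrow> (\<exists>s\<le>t. (f ^^ s) x = y)"

lemma reaches_mono: "reaches f t x y \<Longrightarrow> t \<le> t' \<Longrightarrow> reaches f t' x y"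
  unfolding reaches_def using order_trans by blast

lemma reaches_trans [trans]:
  assumes "reaches f t x y" "reaches f t' y z"
  shows "reaches f (t + t') x z"
proof -
  obtain s s' where "s \<le> t" "s' \<le> t'" "(f ^^ s) x = y" "(f ^^ s') y = z"
    using assms by (auto simp: reaches_def)
  then show ?thesis
    unfolding reaches_def by (intro exI[of _ "s' + s"]) (simp add: funpow_add)
qed

lemma reaches_iterate:
  assumes "\<And>k. k < n \<Longrightarrow> f (x k) = x (Suc k)"
  shows "reaches f n (x 0) (x n)"
proof -
  have "(f ^^ n) (x 0) = x n"
    using assms by (induction n) auto
  then show ?thesis
    by (auto simp: reaches_def)
qed

lemma reaches_refl: "reaches f 0 x x"
  by (simp add: reaches_def)

lemma reaches_step: "f x = y \<Longrightarrow> reaches f 1 x y"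
  unfolding reaches_def by (intro exI[of _ 1]) simp

fun state_step ::
    "('s \<Rightarrow> nat list \<Rightarrow> 's \<times> (nat \<times> move) list) \<Rightarrow> 's set \<Rightarrow> 's \<times> tape list \<Rightarrow> 's \<times> tape list" where
  "state_step \<delta> F (s, ts) =
     (if s \<in> F then (s, ts)
      else let (s', acts) = \<delta> s (map (\<lambda>(t, h). t h) ts) in (s', map2 act acts ts))"

locale finite_state_machine =
  fixes tapes symbols :: nat and Q :: "'s set" and start accept reject :: 's
    and \<delta> :: "'s \<Rightarrow> nat list \<Rightarrow> 's \<times> (nat \<times> move) list"
  assumes tapes_pos: "1 \<le> tapes" and input_symbols: "5 \<le> symbols" and finite_states: "finite Q"
    and states: "start \<in> Q" "accept \<in> Q" "reject \<in> Q" and accept_neq_reject: "accept \<noteq> reject"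
    and closed: "\<And>s syms s' acts. \<lbrakk>s \<in> Q; length syms = tapes; \<delta> s syms = (s', acts)\<rbrakk> \<Longrightarrow>
      s' \<in> Q \<and> length acts = tapes \<and> fst ` set acts \<subseteq> {..<symbols} \<union> set syms"
begin

definition to_tm :: tm where
  "to_tm = \<lparr>n_tapes = tapes, n_symbols = symbols, n_states = card Q,
     start_state = to_nat_on Q start, accept_state = to_nat_on Q accept,
     reject_state = to_nat_on Q reject,
     transition = (\<lambda>q syms. apfst (to_nat_on Q) (\<delta> (from_nat_into Q q) syms))\<rparr>"

lemma to_nat_on_states:
  assumes "s \<in> Q"
  shows "to_nat_on Q s < card Q" "from_nat_into Q (to_nat_on Q s) = s"
    "s' \<in> Q \<Longrightarrow> to_nat_on Q s = to_nat_on Q s' \<longleftrightarrow> s = s'"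
  using assms finite_states to_nat_on_finite[OF finite_states]
  by (auto simp: bij_betw_def countable_finite)

lemma turing_machine_to_tm: "turing_machine to_tm"
  unfolding turing_machine_def
proof (intro conjI allI impI; (elim conjE)?)
  fix q syms q' acts
  assume syms: "length syms = n_tapes to_tm" "set syms \<subseteq> {..<n_symbols to_tm}"
    and trans: "transition to_tm q syms = (q', acts)"
  obtain s where step: "\<delta> (from_nat_into Q q) syms = (s, acts)" "q' = to_nat_on Q s"
    using trans by (auto simp: to_tm_def apfst_def map_prod_def split: prod.splits)
  have "from_nat_into Q q \<in> Q"
    using states(1) by (intro from_nat_into) auto
  from closed[OF this _ step(1)] syms to_nat_on_states(1) step(2)
  show "q' < n_states to_tm" "length acts = n_tapes to_tm"
    "fst ` set acts \<subseteq> {..<n_symbols to_tm}"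
    by (auto simp: to_tm_def)
qed (use tapes_pos input_symbols states accept_neq_reject to_nat_on_states in
    \<open>auto simp: to_tm_def\<close>)

abbreviation state_configs :: "('s \<times> tape list) set" where
  "state_configs \<equiv> Q \<times> {ts. length ts = tapes}"

lemma step_to_tm:
  assumes "x \<in> state_configs"
  shows "step to_tm (apfst (to_nat_on Q) x) = apfst (to_nat_on Q) (state_step \<delta> {accept, reject} x)"
    and "state_step \<delta> {accept, reject} x \<in> state_configs"
proof -
  obtain s ts where x: "x = (s, ts)" "s \<in> Q" "length ts = tapes"
    using assms by auto
  obtain s' acts where trans: "\<delta> s (map (\<lambda>(t, h). t h) ts) = (s', acts)"
    by fastforce
  with x(2,3) closed[OF x(2) _ trans] show "state_step \<delta> {accept, reject} x \<in> state_configs"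
    by (simp add: x(1))
  show "step to_tm (apfst (to_nat_on Q) x) = apfst (to_nat_on Q) (state_step \<delta> {accept, reject} x)"
    using trans states to_nat_on_states[OF x(2)] by (simp add: x(1) to_tm_def)
qed

lemma answers_within_to_tm:
  assumes run: "reaches (state_step \<delta> {accept, reject}) t
      (start, input_tape w # replicate (tapes - 1) (input_tape []))
      (if b then accept else reject, ts)"
  shows "answers_within to_tm w b t"
proof -
  define x where "x = (start, input_tape w # replicate (tapes - 1) (input_tape []))"
  have "initial_config to_tm w = apfst (to_nat_on Q) x"
    by (simp add: initial_config_def to_tm_def x_def)
  moreover have "(step to_tm ^^ k) (apfst (to_nat_on Q) x) =
      apfst (to_nat_on Q) ((state_step \<delta> {accept, reject} ^^ k) x) \<and>
      (state_step \<delta> {accept, reject} ^^ k) x \<in> state_configs" for k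
  proof (induction k)
    case 0
    show ?case
      using states(1) tapes_pos by (simp add: x_def)
  next
    case (Suc k)
    then show ?case
      using step_to_tm by simp
  qed
  moreover obtain k where "k \<le> t" "(state_step \<delta> {accept, reject} ^^ k) x =
      (if b then accept else reject, ts)"
    using run by (auto simp: reaches_def x_def)
  ultimately show ?thesis
    unfolding answers_within_def by (intro exI[of _ k]) (simp add: to_tm_def)
qed

end

section \<open>Words on tapes\<close>

definition word_at :: "(int \<Rightarrow> nat) \<Rightarrow> int \<Rightarrow> nat list \<Rightarrow> bool" where
  "word_at W i xs \<longleftrightarrow> (\<forall>k<length xs. W (i + int k) = xs ! k)"

lemma word_at_Nil [simp]: "word_at W i []"
  by (simp add: word_at_def)

lemma word_at_Cons [simp]: "word_at W i (x # xs) \<longleftrightarrow> W i = x \<and> word_at W (i + 1) xs"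
  by (auto simp: word_at_def All_less_Suc2 add_ac)

lemma word_at_append [simp]:
  "word_at W i (xs @ ys) \<longleftrightarrow> word_at W i xs \<and> word_at W (i + int (length xs)) ys"
  by (induction xs arbitrary: i) (auto simp: add.assoc)

lemma word_at_in_set: "word_at W i xs \<Longrightarrow> k < length xs \<Longrightarrow> W (i + int k) \<in> set xs"
  by (simp add: word_at_def)

definition contents :: "nat list \<Rightarrow> int \<Rightarrow> nat" where
  "contents w i = (if 0 \<le> i \<and> i < int (length w) then w ! nat i else 0)"

lemma input_tape_eq_contents: "input_tape w = (contents w, 0)"
  by (simp add: input_tape_def contents_def fun_eq_iff)

lemma word_at_contents: "word_at (contents w) 0 w"
  by (simp add: word_at_def contents_def)

lemma contents_eq_0_iff:
  assumes "0 \<notin> set w"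
  shows "contents w i = 0 \<longleftrightarrow> i < 0 \<or> int (length w) \<le> i"
proof -
  have "w ! nat i \<noteq> 0" if "0 \<le> i" "i < int (length w)"
    using assms that by (metis nat_less_iff nth_mem)
  then show ?thesis
    by (auto simp: contents_def)
qed

lemma set_binary: "set (binary v) \<subseteq> {1, 2}"
  by (induction v rule: binary.induct) (subst binary.simps, auto)

lemma binary_neq_Nil: "binary v \<noteq> []"
  by (subst binary.simps) simp

primrec binary_value :: "nat list \<Rightarrow> nat" where
  "binary_value [] = 0"
| "binary_value (x # xs) = (x - 1) + 2 * binary_value xs"

lemma binary_value_binary: "binary_value (binary v) = v"
  by (induction v rule: binary.induct) (subst binary.simps, auto)

lemma binary_eq_iff: "binary v = binary u \<longleftrightarrow> v = u"
  by (metis binary_value_binary)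

lemma word_at_binary_neq_4:
  assumes "word_at W i (binary v)"
  shows "W i \<noteq> 4"
  using assms set_binary[of v] binary_neq_Nil[of v] by (cases "binary v") auto

lemma encode_vertices_simps [simp]:
  "encode_vertices [] = [4]"
  "encode_vertices (v # vs) = binary v @ 3 # encode_vertices vs"
  by (simp_all add: encode_vertices_def)

definition encode_lists :: "nat list list \<Rightarrow> nat list" where
  "encode_lists L = concat (map encode_vertices L)"

lemma encode_lists_simps [simp]:
  "encode_lists [] = []"
  "encode_lists (vs # L) = encode_vertices vs @ encode_lists L"
  "encode_lists (L @ L') = encode_lists L @ encode_lists L'"
  by (simp_all add: encode_lists_def)

lemma zero_notin_encode_lists: "0 \<notin> set (encode_lists L)"
proof -
  have "0 \<notin> set (binary v)" for v
    using set_binary[of v] by auto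
  then show ?thesis
    by (auto simp: encode_lists_def encode_vertices_def)
qed

definition vertex_type :: "nat list list \<Rightarrow> nat \<Rightarrow> nat set" where
  "vertex_type L v = {k. k < length L \<and> v \<in> set (L ! k)}"

lemma vertex_type_snoc:
  "vertex_type (L @ [vs]) v =
     (if v \<in> set vs then insert (length L) (vertex_type L v) else vertex_type L v)"
  by (auto simp: vertex_type_def nth_append less_Suc_eq)

section \<open>A machine counting the vertices of each type\<close>

datatype mode = Copy | Back | Compare | Skip | Rewind | Advance | Restart | Accept | Reject

type_synonym memory = "(nat set \<Rightarrow> nat) \<times> nat set \<times> nat"

type_synonym state = "mode \<times> memory"

definition bump :: "nat \<Rightarrow> nat set \<Rightarrow> (nat set \<Rightarrow> nat) \<Rightarrow> nat set \<Rightarrow> nat" where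
  "bump N T c = c(T := min N (c T + 1))"

lemma fold_bump_eq_truncated_count:
  assumes "distinct vs"
  shows "fold (bump N) (map \<tau> vs) (\<lambda>_. 0) = truncated_count N (set vs) \<tau>"
  using assms
proof (induction vs rule: rev_induct)
  case Nil
  show ?case
    by (simp add: truncated_count_def type_count_def fun_eq_iff)
next
  case (snoc v vs)
  then have "fold (bump N) (map \<tau> (vs @ [v])) (\<lambda>_. 0) = bump N (\<tau> v) (truncated_count N (set vs) \<tau>)"
    by simp
  also have "\<dots> = truncated_count N (insert v (set vs)) \<tau>"
    using snoc.prems by (auto simp: bump_def truncated_count_def type_count_insert fun_eq_iff)
  finally show ?case
    by simp
qed

definition verdict :: "bool \<Rightarrow> state" where
  "verdict b = (if b then Accept else Reject, \<lambda>_. 0, {}, 0)"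

text \<open>After the input has been copied to the second tape, neither tape is modified any more.  The
  first head stands at a vertex name of the initial vertex list while the second head passes over
  the whole word and the names it meets are compared with that vertex.  In a state \<open>(q, c, S, k)\<close>
  the second head is in the \<open>k\<close>-th list of the word, \<open>S\<close> collects the lists found to contain the
  current vertex, and \<open>c\<close> counts the vertices already treated by type, up to the bound \<open>N\<close>.  The
  bound \<open>K\<close> only serves to keep the set of states finite.\<close>

fun census :: "nat \<Rightarrow> nat \<Rightarrow> ((nat set \<Rightarrow> nat) \<Rightarrow> bool) \<Rightarrow> state \<Rightarrow> nat list
    \<Rightarrow> state \<times> (nat \<times> move) list" where
  "census K N D (Copy, r) [a, b] =
     (if a = 0 then ((Back, r), [(a, Move_Left), (b, Move_Left)])
      else ((Copy, r), [(a, Move_Right), (a, Move_Right)]))"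
| "census K N D (Back, r) [a, b] =
     (if b = 0 then ((Compare, r), [(a, Move_Right), (b, Move_Right)])
      else ((Back, r), [(a, Move_Left), (b, Move_Left)]))"
| "census K N D (Compare, c, S, k) [a, b] =
     (if a = 4 then (verdict (D c), [(a, Stay), (b, Stay)])
      else if b = 0 then ((Advance, bump N S c, {}, 0), [(a, Stay), (b, Move_Left)])
      else if b = 4 then ((Compare, c, S, min K (k + 1)), [(a, Stay), (b, Move_Right)])
      else if a \<noteq> b then ((Skip, c, S, k), [(a, Move_Left), (b, Stay)])
      else if a = 3 then ((Skip, c, insert k S, k), [(a, Move_Left), (b, Stay)])
      else ((Compare, c, S, k), [(a, Move_Right), (b, Move_Right)]))"
| "census K N D (Skip, r) [a, b] =
     (if b = 3 then (Rewind, r) else (Skip, r), [(a, Stay), (b, Move_Right)])"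
| "census K N D (Rewind, r) [a, b] =
     (if a = 0 \<or> a = 3 then ((Compare, r), [(a, Move_Right), (b, Stay)])
      else ((Rewind, r), [(a, Move_Left), (b, Stay)]))"
| "census K N D (Advance, r) [a, b] =
     (if a = 3 then (Restart, r) else (Advance, r), [(a, Move_Right), (b, Stay)])"
| "census K N D (Restart, r) [a, b] =
     (if b = 0 then ((Compare, r), [(a, Stay), (b, Move_Right)])
      else ((Restart, r), [(a, Stay), (b, Move_Left)]))"
| "census K N D (Accept, r) [a, b] = ((Accept, r), [(a, Stay), (b, Stay)])"
| "census K N D (Reject, r) [a, b] = ((Reject, r), [(a, Stay), (b, Stay)])"

definition memories :: "nat \<Rightarrow> nat \<Rightarrow> memory set" where
  "memories K N =
     {c. \<forall>T. (T \<in> Pow {..K} \<longrightarrow> c T \<in> {..N}) \<and> (T \<notin> Pow {..K} \<longrightarrow> c T = 0)}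
       \<times> Pow {..K} \<times> {..K}"

definition census_states :: "nat \<Rightarrow> nat \<Rightarrow> state set" where
  "census_states K N = UNIV \<times> memories K N"

lemma finite_census_states: "finite (census_states K N)"
proof -
  have "(UNIV :: mode set) \<subseteq>
      {Copy, Back, Compare, Skip, Rewind, Advance, Restart, Accept, Reject}"
    using mode.exhaust by blast
  then have "finite (UNIV :: mode set)"
    by (rule finite_subset) simp
  moreover have "finite (memories K N)"
    unfolding memories_def by (intro finite_cartesian_product finite_set_of_finite_funs) auto
  ultimately show ?thesis
    unfolding census_states_def by (rule finite_cartesian_product)
qed

lemma memories_closed:
  assumes "(c, S, k) \<in> memories K N"
  shows "(bump N S c, {}, 0) \<in> memories K N" "(c, insert k S, k) \<in> memories K N"
    "(c, S, min K (k + 1)) \<in> memories K N"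
  using assms by (auto simp: memories_def bump_def)

lemma verdict_in_census_states: "verdict b \<in> census_states K N"
  by (simp add: verdict_def census_states_def memories_def)

lemma census_closed:
  assumes s: "s \<in> census_states K N" and "length syms = 2"
    and trans: "census K N D s syms = (s', acts)"
  shows "s' \<in> census_states K N \<and> length acts = 2 \<and> fst ` set acts \<subseteq> {..<5} \<union> set syms"
proof -
  obtain a b where "syms = [a, b]"
    using \<open>length syms = 2\<close> by (auto simp: numeral_2_eq_2 length_Suc_conv)
  moreover obtain q c S k where "s = (q, c, S, k)" "(c, S, k) \<in> memories K N"
    using s by (auto simp: census_states_def)
  ultimately show ?thesis
    using trans memories_closed[of c S k K N] verdict_in_census_states[of _ K N]
    by (cases q) (auto simp: census_states_def split: if_splits)
qed

context
  fixes K N :: nat and D :: "(nat set \<Rightarrow> nat) \<Rightarrow> bool"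
begin

abbreviation census_step :: "state \<times> tape list \<Rightarrow> state \<times> tape list" where
  "census_step \<equiv> state_step (census K N D) {verdict True, verdict False}"

abbreviation scan :: "(int \<Rightarrow> nat) \<Rightarrow> state \<Rightarrow> int \<Rightarrow> int \<Rightarrow> state \<times> tape list" where
  "scan W s i j \<equiv> (s, [(W, i), (W, j)])"

lemma scan_step:
  assumes "census K N D s [W i, W j] = (s', [(W i, d), (W j, e)])"
    and "s \<notin> {verdict True, verdict False}"
  shows "reaches census_step 1 (scan W s i j) (scan W s' (i + offset d) (j + offset e))"
  using assms by (intro reaches_step) simp

lemma scan_loop:
  assumes "\<And>k. k < n \<Longrightarrow> census K N D s [W (i + offset d * int k), W (j + offset e * int k)] =
      (s, [(W (i + offset d * int k), d), (W (j + offset e * int k), e)])"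
    and "s \<notin> {verdict True, verdict False}"
  shows "reaches census_step n (scan W s i j)
    (scan W s (i + offset d * int n) (j + offset e * int n))"
proof -
  let ?x = "\<lambda>k. scan W s (i + offset d * int k) (j + offset e * int k)"
  have "census_step (?x k) = ?x (Suc k)" if "k < n" for k
    using assms(1)[OF that] assms(2) by (simp add: algebra_simps)
  from reaches_iterate[of n census_step ?x, OF this] show ?thesis
    by simp
qed

lemma Skip_run:
  assumes "word_at W j (ys @ [3])" "3 \<notin> set ys"
  shows "reaches census_step (length ys + 1)
    (scan W (Skip, r) i j) (scan W (Rewind, r) i (j + int (length ys) + 1))"
proof -
  have "W (j + int k) \<noteq> 3" if "k < length ys" for k
    using assms that word_at_in_set[of W j ys k] by auto
  then have "reaches census_step (length ys)
      (scan W (Skip, r) i j) (scan W (Skip, r) i (j + int (length ys)))"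
    using scan_loop[of "length ys" "(Skip, r)" W i Stay j Move_Right] by (simp add: verdict_def)
  also have "reaches census_step 1 \<dots> (scan W (Rewind, r) i (j + int (length ys) + 1))"
    using scan_step[of "(Skip, r)" W i _ "(Rewind, r)" Stay Move_Right] assms(1)
    by (simp add: verdict_def)
  finally show ?thesis .
qed

lemma Rewind_run:
  assumes "word_at W i xs" "set xs \<subseteq> {1, 2}" "W (i - 1) \<in> {0, 3}"
  shows "reaches census_step (length xs + 1)
    (scan W (Rewind, r) (i + int (length xs) - 1) j) (scan W (Compare, r) i j)"
proof -
  let ?n = "length xs"
  have "W (i + int ?n - 1 - int k) \<notin> {0, 3}" if "k < ?n" for k
  proof -
    have "W (i + int (?n - 1 - k)) \<in> set xs"
      using that by (intro word_at_in_set assms(1)) simp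
    with assms(2) that show ?thesis
      by (auto simp: algebra_simps)
  qed
  then have "reaches census_step ?n
      (scan W (Rewind, r) (i + int ?n - 1) j) (scan W (Rewind, r) (i - 1) j)"
    using scan_loop[of ?n "(Rewind, r)" W "i + int ?n - 1" Move_Left j Stay]
    by (simp add: verdict_def)
  also have "reaches census_step 1 \<dots> (scan W (Compare, r) i j)"
    using scan_step[of "(Rewind, r)" W "i - 1" j "(Compare, r)" Move_Right Stay] assms(3)
    by (auto simp: verdict_def)
  finally show ?thesis .
qed

lemma Skip_Rewind_run:
  assumes "word_at W i xs" "set xs \<subseteq> {1, 2}" "W (i - 1) \<in> {0, 3}"
    and "word_at W j (ys @ [3])" "3 \<notin> set ys"
  shows "reaches census_step (length ys + 1 + (length xs + 1))
    (scan W (Skip, r) (i + int (length xs) - 1) j)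
    (scan W (Compare, r) i (j + int (length ys) + 1))"
  using Skip_run[OF assms(4,5)] Rewind_run[OF assms(1-3)] by (rule reaches_trans)

lemma Compare_stop_run:
  assumes "word_at W i us" "set us \<subseteq> {1, 2}" "W (i - 1) \<in> {0, 3}"
    and "word_at W j (ys @ [3])" "set ys \<subseteq> {1, 2}"
    and stop: "census K N D (Compare, c, S, k) [W (i + int (length us)), W j] =
      ((Skip, c, S', k), [(W (i + int (length us)), Move_Left), (W j, Stay)])"
  shows "reaches census_step (length us + length ys + 3)
    (scan W (Compare, c, S, k) (i + int (length us)) j)
    (scan W (Compare, c, S', k) i (j + int (length ys) + 1))"
proof -
  have "reaches census_step 1 (scan W (Compare, c, S, k) (i + int (length us)) j)
      (scan W (Skip, c, S', k) (i + int (length us) - 1) j)"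
    using scan_step[OF stop] by (simp add: verdict_def)
  also have "reaches census_step (length ys + 1 + (length us + 1)) \<dots>
      (scan W (Compare, c, S', k) i (j + int (length ys) + 1))"
    using assms(1-5) by (intro Skip_Rewind_run) auto
  finally show ?thesis
    by (rule reaches_mono) simp
qed

lemma Compare_match_step:
  assumes "W i = W j" "W j \<in> {1, 2}"
  shows "reaches census_step 1
    (scan W (Compare, c, S, k) i j) (scan W (Compare, c, S, k) (i + 1) (j + 1))"
  using scan_step[of "(Compare, c, S, k)" W i j "(Compare, c, S, k)" Move_Right Move_Right] assms
  by (auto simp: verdict_def)

text \<open>The names \<open>us @ xs\<close> and \<open>us @ ys\<close> have already been found to agree on \<open>us\<close>.\<close>

lemma Compare_suffix_run:
  assumes "word_at W i (us @ xs @ [3])" "set (us @ xs) \<subseteq> {1, 2}" "W (i - 1) \<in> {0, 3}"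
    and "word_at W j (ys @ [3])" "set ys \<subseteq> {1, 2}"
  shows "reaches census_step (length (us @ xs) + length ys + 3)
    (scan W (Compare, c, S, k) (i + int (length us)) j)
    (scan W (Compare, c, if xs = ys then insert k S else S, k) i (j + int (length ys) + 1))"
  using assms
proof (induction xs arbitrary: us ys j)
  case Nil
  have "census K N D (Compare, c, S, k) [W (i + int (length us)), W j] =
      ((Skip, c, if [] = ys then insert k S else S, k),
       [(W (i + int (length us)), Move_Left), (W j, Stay)])"
    using Nil.prems by (cases ys) auto
  with Nil.prems show ?case
    using Compare_stop_run[of W i us j ys c S k "if [] = ys then insert k S else S"] by simp
next
  case (Cons x xs)
  let ?i = "i + int (length us)"
  show ?case
  proof (cases "\<exists>zs. ys = x # zs")
    case True
    then obtain zs where ys: "ys = x # zs"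
      by blast
    have "reaches census_step 1
        (scan W (Compare, c, S, k) ?i j) (scan W (Compare, c, S, k) (?i + 1) (j + 1))"
      using Cons.prems by (intro Compare_match_step) (auto simp: ys)
    also have "reaches census_step (length ((us @ [x]) @ xs) + length zs + 3) \<dots>
        (scan W (Compare, c, if xs = zs then insert k S else S, k) i (j + 1 + int (length zs) + 1))"
      using Cons.IH[of "us @ [x]" "j + 1" zs] Cons.prems
      by (simp add: ys add_ac split del: if_split)
    finally show ?thesis
      by (simp add: ys add_ac split del: if_split)
  next
    case False
    then have "census K N D (Compare, c, S, k) [W ?i, W j] =
        ((Skip, c, S, k), [(W ?i, Move_Left), (W j, Stay)])"
      using Cons.prems by (cases ys) auto
    with Cons.prems have "reaches census_step (length us + length ys + 3)
        (scan W (Compare, c, S, k) ?i j) (scan W (Compare, c, S, k) i (j + int (length ys) + 1))"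
      by (intro Compare_stop_run) auto
    with False show ?thesis
      by (auto intro: reaches_mono)
  qed
qed

lemma Compare_name_run:
  assumes x: "word_at W i (binary x @ [3])" "W (i - 1) \<in> {0, 3}"
    and y: "word_at W j (binary y @ [3])"
  shows "reaches census_step (length (binary x) + length (binary y) + 3)
    (scan W (Compare, c, S, k) i j)
    (scan W (Compare, c, if x = y then insert k S else S, k) i (j + int (length (binary y)) + 1))"
  using Compare_suffix_run[of W i "[]" "binary x" j "binary y" c S k] assms set_binary
  by (simp add: binary_eq_iff)

lemma Compare_list_run:
  assumes x: "word_at W i (binary x @ [3])" "W (i - 1) \<in> {0, 3}"
    and "word_at W j (encode_vertices ys)"
  shows "reaches census_step ((length (binary x) + 3) * length (encode_vertices ys))
    (scan W (Compare, c, S, k) i j)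
    (scan W (Compare, c, if x \<in> set ys then insert k S else S, min K (k + 1)) i
      (j + int (length (encode_vertices ys))))"
  using assms(3)
proof (induction ys arbitrary: j S)
  case Nil
  have "W i \<noteq> 4"
    using x(1) word_at_binary_neq_4 by auto
  with Nil have start: "census K N D (Compare, c, S, k) [W i, W j] =
      ((Compare, c, S, min K (k + 1)), [(W i, Stay), (W j, Move_Right)])"
    by simp
  from scan_step[OF start] have "reaches census_step 1 (scan W (Compare, c, S, k) i j)
      (scan W (Compare, c, S, min K (k + 1)) i (j + 1))"
    by (simp add: verdict_def)
  then show ?case
    by (auto intro: reaches_mono)
next
  case (Cons y ys)
  let ?S = "if x = y then insert k S else S" and ?j = "j + int (length (binary y)) + 1"
  have y: "word_at W j (binary y @ [3])" and ys: "word_at W ?j (encode_vertices ys)"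
    using Cons.prems by simp_all
  note Compare_name_run[OF x y, of c S k]
  also note Cons.IH[OF ys, of ?S]
  also have "(if x \<in> set ys then insert k ?S else ?S) =
      (if x \<in> set (y # ys) then insert k S else S)"
    by auto
  also have "?j + int (length (encode_vertices ys)) = j + int (length (encode_vertices (y # ys)))"
    by simp
  finally show ?case
    by (rule reaches_mono) (simp add: algebra_simps)
qed

lemma Compare_lists_run:
  assumes x: "word_at W i (binary x @ [3])" "W (i - 1) \<in> {0, 3}"
    and "word_at W 0 (encode_lists L)" "length L \<le> K"
  shows "reaches census_step ((length (binary x) + 3) * length (encode_lists L))
    (scan W (Compare, c, {}, 0) i 0)
    (scan W (Compare, c, vertex_type L x, length L) i (int (length (encode_lists L))))"
  using assms(3,4)
proof (induction L rule: rev_induct)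
  case Nil
  show ?case
    by (simp add: vertex_type_def reaches_refl)
next
  case (snoc ys L)
  let ?n = "length (encode_lists L)"
  have "word_at W (int ?n) (encode_vertices ys)"
    using snoc.prems by simp
  note last_list = Compare_list_run[OF x this, of c "vertex_type L x" "length L"]
  have "reaches census_step ((length (binary x) + 3) * ?n) (scan W (Compare, c, {}, 0) i 0)
      (scan W (Compare, c, vertex_type L x, length L) i (int ?n))"
    using snoc by simp
  also note last_list
  finally show ?case
    using snoc.prems by (simp add: vertex_type_snoc algebra_simps)
qed

lemma Advance_run:
  assumes "word_at W i (xs @ [3])" "3 \<notin> set xs"
  shows "reaches census_step (length xs + 1)
    (scan W (Advance, r) i j) (scan W (Restart, r) (i + int (length xs) + 1) j)"
proof -
  have "W (i + int k) \<noteq> 3" if "k < length xs" for k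
    using assms that word_at_in_set[of W i xs k] by auto
  then have "reaches census_step (length xs)
      (scan W (Advance, r) i j) (scan W (Advance, r) (i + int (length xs)) j)"
    using scan_loop[of "length xs" "(Advance, r)" W i Move_Right j Stay] by (simp add: verdict_def)
  also have "reaches census_step 1 \<dots> (scan W (Restart, r) (i + int (length xs) + 1) j)"
    using scan_step[of "(Advance, r)" W _ j "(Restart, r)" Move_Right Stay] assms(1)
    by (simp add: verdict_def)
  finally show ?thesis .
qed

lemma Restart_run:
  assumes "0 \<notin> set w"
  shows "reaches census_step (length w + 1)
    (scan (contents w) (Restart, r) i (int (length w) - 1)) (scan (contents w) (Compare, r) i 0)"
proof -
  let ?W = "contents w" and ?n = "length w"
  have "reaches census_step ?n
      (scan ?W (Restart, r) i (int ?n - 1)) (scan ?W (Restart, r) i (- 1))"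
    using scan_loop[of ?n "(Restart, r)" ?W i Stay "int ?n - 1" Move_Left]
    by (simp add: verdict_def contents_eq_0_iff[OF assms])
  also have "reaches census_step 1 \<dots> (scan ?W (Compare, r) i 0)"
    using scan_step[of "(Restart, r)" ?W i "- 1" "(Compare, r)" Stay Move_Right]
    by (simp add: verdict_def contents_def)
  finally show ?thesis .
qed

lemma Copy_run:
  assumes "0 \<notin> set w"
  shows "reaches census_step (length w + 1)
    ((Copy, r), [input_tape w, input_tape []])
    (scan (contents w) (Back, r) (int (length w) - 1) (int (length w) - 1))"
proof -
  let ?W = "contents w" and ?n = "length w"
  define U where "U k p = (if p < int k then ?W p else 0)" for k p
  have "census_step ((Copy, r), [(?W, int k), (U k, int k)]) =
      ((Copy, r), [(?W, int (Suc k)), (U (Suc k), int (Suc k))])" if "k < ?n" for k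
  proof -
    have "(U k)(int k := ?W (int k)) = U (Suc k)"
      by (auto simp: U_def)
    with that show ?thesis
      by (simp add: verdict_def contents_eq_0_iff[OF assms] add.commute)
  qed
  then have "reaches census_step ?n ((Copy, r), [(?W, int 0), (U 0, int 0)])
      ((Copy, r), [(?W, int ?n), (U ?n, int ?n)])"
    by (rule reaches_iterate)
  also have "U 0 = contents []"
    by (auto simp: U_def contents_def)
  also have "U ?n = ?W"
    by (auto simp: U_def contents_def)
  also have "reaches census_step 1 (scan ?W (Copy, r) (int ?n) (int ?n))
      (scan ?W (Back, r) (int ?n - 1) (int ?n - 1))"
    using scan_step[of "(Copy, r)" ?W "int ?n" "int ?n" "(Back, r)" Move_Left Move_Left]
    by (simp add: verdict_def contents_def)
  finally show ?thesis
    by (simp add: input_tape_eq_contents)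
qed

lemma Back_run:
  assumes "0 \<notin> set w"
  shows "reaches census_step (length w + 1)
    (scan (contents w) (Back, r) (int (length w) - 1) (int (length w) - 1))
    (scan (contents w) (Compare, r) 0 0)"
proof -
  let ?W = "contents w" and ?n = "length w"
  have "reaches census_step ?n
      (scan ?W (Back, r) (int ?n - 1) (int ?n - 1)) (scan ?W (Back, r) (- 1) (- 1))"
    using scan_loop[of ?n "(Back, r)" ?W "int ?n - 1" Move_Left "int ?n - 1" Move_Left]
    by (simp add: verdict_def contents_eq_0_iff[OF assms])
  also have "reaches census_step 1 \<dots> (scan ?W (Compare, r) 0 0)"
    using scan_step[of "(Back, r)" ?W "- 1" "- 1" "(Compare, r)" Move_Right Move_Right]
    by (simp add: verdict_def contents_def)
  finally show ?thesis .
qed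

lemma vertex_run:
  assumes w: "w = encode_lists L" and lists_le: "length L \<le> K"
    and x: "word_at (contents w) i (binary x @ [3])" "contents w (i - 1) \<in> {0, 3}"
  shows "reaches census_step (4 * (length w + 1) * (length (binary x) + 1))
    (scan (contents w) (Compare, c, {}, 0) i 0)
    (scan (contents w) (Compare, bump N (vertex_type L x) c, {}, 0)
      (i + int (length (binary x)) + 1) 0)"
proof -
  let ?W = "contents w" and ?n = "length w" and ?b = "length (binary x)"
  let ?r = "(bump N (vertex_type L x) c, {}, 0)"
  have nonblank: "0 \<notin> set w"
    by (simp add: w zero_notin_encode_lists)
  have "reaches census_step ((?b + 3) * ?n) (scan ?W (Compare, c, {}, 0) i 0)
      (scan ?W (Compare, c, vertex_type L x, length L) i (int ?n))"
    using Compare_lists_run[OF x _ lists_le, of c] word_at_contents[of w] by (simp add: w)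
  also have "reaches census_step 1 \<dots> (scan ?W (Advance, ?r) i (int ?n - 1))"
    using scan_step[of "(Compare, c, vertex_type L x, length L)" ?W i "int ?n" "(Advance, ?r)"
        Stay Move_Left] word_at_binary_neq_4[of ?W i x] x(1)
    by (simp add: verdict_def contents_eq_0_iff[OF nonblank])
  also have "reaches census_step (?b + 1) \<dots> (scan ?W (Restart, ?r) (i + int ?b + 1) (int ?n - 1))"
    using set_binary[of x] by (intro Advance_run x(1)) auto
  also note Restart_run[OF nonblank]
  finally show ?thesis
    by (rule reaches_mono) (simp add: algebra_simps)
qed

lemma vertices_run:
  assumes w: "w = encode_lists L" and lists_le: "length L \<le> K"
    and "word_at (contents w) i (encode_vertices vs)" "contents w (i - 1) \<in> {0, 3}"
  shows "\<exists>ts. reaches census_step (4 * (length w + 1) * length (encode_vertices vs))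
    (scan (contents w) (Compare, c, {}, 0) i 0)
    (verdict (D (fold (bump N) (map (vertex_type L) vs) c)), ts)"
  using assms(3-)
proof (induction vs arbitrary: i c)
  case Nil
  then have "reaches census_step 1 (scan (contents w) (Compare, c, {}, 0) i 0)
      (scan (contents w) (verdict (D c)) i 0)"
    using scan_step[of "(Compare, c, {}, 0)" "contents w" i 0 "verdict (D c)" Stay Stay]
    by (simp add: verdict_def)
  then have "reaches census_step (4 * (length w + 1) * length (encode_vertices []))
      (scan (contents w) (Compare, c, {}, 0) i 0) (scan (contents w) (verdict (D c)) i 0)"
    by (rule reaches_mono) simp
  then show ?case
    by auto
next
  case (Cons v vs)
  let ?W = "contents w" and ?i = "i + int (length (binary v)) + 1"
  let ?c = "bump N (vertex_type L v) c"
  have v: "word_at ?W i (binary v @ [3])" and vs: "word_at ?W ?i (encode_vertices vs)"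
    and separator: "?W (?i - 1) \<in> {0, 3}"
    using Cons.prems(1) by simp_all
  obtain ts where rest: "reaches census_step (4 * (length w + 1) * length (encode_vertices vs))
      (scan ?W (Compare, ?c, {}, 0) ?i 0)
      (verdict (D (fold (bump N) (map (vertex_type L) vs) ?c)), ts)"
    using Cons.IH[OF vs separator] by blast
  note vertex_run[OF w lists_le v Cons.prems(2), of c]
  also note rest
  finally show ?case
    by (intro exI[of _ ts]) (simp add: algebra_simps)
qed

lemma census_run:
  assumes w: "w = encode_lists (vs # es)" and K: "length es < K"
  shows "\<exists>ts. reaches census_step (4 * (length w + 1)\<^sup>2)
    ((Copy, \<lambda>_. 0, {}, 0), [input_tape w, input_tape []])
    (verdict (D (fold (bump N) (map (vertex_type (vs # es)) vs) (\<lambda>_. 0))), ts)"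
proof -
  let ?r = "(\<lambda>_. 0, {}, 0) :: memory" and ?n = "length w"
  have nonblank: "0 \<notin> set w"
    by (simp only: w zero_notin_encode_lists not_False_eq_True)
  have "word_at (contents w) 0 (encode_vertices vs)"
    using word_at_contents[of w] by (simp add: w)
  with K vertices_run[OF w, of 0 vs "\<lambda>_. 0"] obtain ts where
    vertices: "reaches census_step (4 * (?n + 1) * length (encode_vertices vs))
      (scan (contents w) (Compare, ?r) 0 0)
      (verdict (D (fold (bump N) (map (vertex_type (vs # es)) vs) (\<lambda>_. 0))), ts)"
    by (auto simp: contents_def)
  note Copy_run[OF nonblank, of ?r]
  also note Back_run[OF nonblank]
  also note vertices
  also have "?n + 1 + (?n + 1) + 4 * (?n + 1) * length (encode_vertices vs) \<le> 4 * (?n + 1)\<^sup>2"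
  proof -
    have "4 * (?n + 1) * length (encode_vertices vs) \<le> 4 * (?n + 1) * ?n"
      by (simp add: w)
    then show ?thesis
      by (simp add: power2_eq_square algebra_simps)
  qed
  finally (reaches_mono) show ?thesis
    by blast
qed

end

lemma turing_machine_deciding_type_counts:
  obtains M where "turing_machine M"
    and "\<And>vs es w. \<lbrakk>distinct vs; length es = m; w = encode_lists (vs # es)\<rbrakk> \<Longrightarrow>
      answers_within M w (D (truncated_count N (set vs) (vertex_type (vs # es))))
        (4 * (length w + 1)\<^sup>2)"
proof -
  let ?K = "Suc m" and ?start = "(Copy, \<lambda>_. 0, {}, 0) :: state"
  interpret finite_state_machine 2 5 "census_states ?K N" ?start "verdict True" "verdict False"
    "census ?K N D"
  proof
    show "?start \<in> census_states ?K N"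
      by (simp add: census_states_def memories_def)
    show "verdict True \<noteq> verdict False"
      by (simp add: verdict_def)
  qed (use census_closed finite_census_states verdict_in_census_states in simp_all)
  show thesis
  proof
    show "turing_machine to_tm"
      by (rule turing_machine_to_tm)
    fix vs es w
    assume "distinct vs" "length es = m" and w: "w = encode_lists (vs # es)"
    let ?b = "D (truncated_count N (set vs) (vertex_type (vs # es)))"
    obtain ts where
      "reaches (state_step (census ?K N D) {verdict True, verdict False}) (4 * (length w + 1)\<^sup>2)
        (?start, [input_tape w, input_tape []]) (verdict ?b, ts)"
      using census_run[OF w, of ?K N D] \<open>length es = m\<close>
        fold_bump_eq_truncated_count[OF \<open>distinct vs\<close>]
      by auto
    then show "answers_within to_tm w ?b (4 * (length w + 1)\<^sup>2)"
      by (intro answers_within_to_tm[of _ _ _ ts]) (cases ?b; simp)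
  qed
qed

section \<open>The decision procedure\<close>

text \<open>Hyperedges are numbered from \<open>1\<close>, as list \<open>0\<close> of the word is the list of all vertices.\<close>

lemma has_support_satisfying_iff_has_indexed_support:
  assumes H: "wf_hypergraph H" and vs: "set vs = hverts H" and es: "set (map set es) = hedges H"
  shows "has_support_satisfying P H \<longleftrightarrow>
    has_indexed_support P (Suc ` {..<length es}) (hverts H) (vertex_type (vs # es))"
proof -
  have edges: "hedges H = (\<lambda>j. set (es ! j)) ` {..<length es}"
    unfolding es[symmetric] by (force simp: in_set_conv_nth)
  have "{v \<in> hverts H. Suc j \<in> vertex_type (vs # es) v} = set (es ! j)" if "j < length es" for j
    using H that unfolding wf_hypergraph_def edges by (auto simp: vertex_type_def)
  then have "support H G \<longleftrightarrow> pverts G = hverts H \<and>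
      indexed_support (Suc ` {..<length es}) (vertex_type (vs # es)) G" for G
    unfolding support_def indexed_support_def edges
    by (auto simp: connected_induce_subgraph_iff)
  then show ?thesis
    by (auto simp: has_support_satisfying_def has_indexed_support_def)
qed

lemma encodesE:
  assumes "encodes w H"
  obtains vs es where "distinct vs" "set vs = hverts H" "set (map set es) = hedges H"
    "length es = card (hedges H)" "w = encode_lists (vs # es)"
proof -
  from assms obtain vs es
    where lists: "distinct vs" "set vs = hverts H" "set (map set es) = hedges H"
    and dist: "distinct (map set es)" and w: "w = concat (map encode_vertices (vs # es))"
    unfolding encodes_def by (elim exE conjE)
  have "length es = card (hedges H)"
    using distinct_card[OF dist] lists(3) by simp
  with lists w show thesis
    by (intro that[of vs es]) (simp_all add: encode_lists_def)
qed

lemma has_support_satisfying_truncated_count: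
  assumes "graph_property P" "closed_under_adding_leaves P"
  obtains N D where "\<And>H vs es.
    \<lbrakk>wf_hypergraph H; set vs = hverts H; set (map set es) = hedges H; length es = m\<rbrakk> \<Longrightarrow>
    has_support_satisfying P H \<longleftrightarrow> D (truncated_count N (set vs) (vertex_type (vs # es)))"
proof -
  obtain N D where decides: "\<And>V \<tau>. \<lbrakk>finite V; \<tau> ` V \<subseteq> Pow {..m}\<rbrakk> \<Longrightarrow>
      has_indexed_support P (Suc ` {..<m}) V \<tau> \<longleftrightarrow> D (truncated_count N V \<tau>)"
    by (rule has_indexed_support_truncated_count[OF assms, of "Pow {..m}"]) auto
  show thesis
  proof (rule that)
    fix H vs es
    assume H: "wf_hypergraph H" "set vs = hverts H" "set (map set es) = hedges H"
      and len: "length es = m"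
    have "vertex_type (vs # es) ` set vs \<subseteq> Pow {..m}"
      using len by (auto simp: vertex_type_def)
    from decides[OF finite_set this] has_support_satisfying_iff_has_indexed_support[OF H, of P]
    show "has_support_satisfying P H \<longleftrightarrow> D (truncated_count N (set vs) (vertex_type (vs # es)))"
      by (simp add: H(2) len)
  qed
qed

lemma ex_turing_machine_deciding_support:
  assumes "graph_property P" "closed_under_adding_leaves P"
  shows "\<exists>M. turing_machine M \<and>
    (\<forall>H w. wf_hypergraph H \<and> card (hedges H) = m \<and> encodes w H \<longrightarrow>
      answers_within M w (has_support_satisfying P H) (4 * (length w + 1)\<^sup>2))"
proof -
  obtain N D where decides: "\<And>H vs es.
      \<lbrakk>wf_hypergraph H; set vs = hverts H; set (map set es) = hedges H; length es = m\<rbrakk> \<Longrightarrow>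
      has_support_satisfying P H \<longleftrightarrow> D (truncated_count N (set vs) (vertex_type (vs # es)))"
    by (rule has_support_satisfying_truncated_count[OF assms, where m = m]) blast
  obtain M where machine: "turing_machine M" "\<And>vs es w.
      \<lbrakk>distinct vs; length es = m; w = encode_lists (vs # es)\<rbrakk> \<Longrightarrow>
      answers_within M w (D (truncated_count N (set vs) (vertex_type (vs # es))))
        (4 * (length w + 1)\<^sup>2)"
    by (rule turing_machine_deciding_type_counts[where m = m and D = D and N = N]) blast
  have "answers_within M w (has_support_satisfying P H) (4 * (length w + 1)\<^sup>2)"
    if H: "wf_hypergraph H" "card (hedges H) = m" "encodes w H" for H w
    using H(3)
  proof (rule encodesE)
    fix vs es
    assume "distinct vs" "set vs = hverts H" "set (map set es) = hedges H"
      "length es = card (hedges H)" "w = encode_lists (vs # es)"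
    with machine(2)[of vs es w] decides[of H vs es] H(1,2) show ?thesis
      by simp
  qed
  with machine(1) show ?thesis
    by blast
qed

theorem theorem3:
  fixes P :: "ngraph \<Rightarrow> bool"
  assumes "graph_property P"
    and "closed_under_adding_leaves P"
  shows "\<exists>(f :: nat \<Rightarrow> nat) (p :: nat poly). \<forall>m. \<exists>M. turing_machine M \<and>
           (\<forall>H w. wf_hypergraph H \<and> card (hedges H) = m \<and> encodes w H \<longrightarrow>
              answers_within M w (has_support_satisfying P H) (f m * poly p (length w)))"
proof -
  have "poly ([:1, 1:]\<^sup>2) n = (n + 1)\<^sup>2" for n :: nat
    by (simp add: add.commute)
  with ex_turing_machine_deciding_support[OF assms] show ?thesis
    by (intro exI[of _ "\<lambda>_. 4"] exI[of _ "[:1, 1:]\<^sup>2"]) simp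
qed

end
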